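(* Consider the system of difference equations $$x_{n+1}=\frac{y_{n-2}x_{n-1}y_n+x_{n-1}y_{n-2}+y_{n-2}+1}{y_{n-2}x_{n-1}y_n},\qquad y_{n+1}=\frac{x_{n-2}y_{n-1}x_n+y_{n-1}x_{n-2}+x_{n-2}+1}{x_{n-2}y_{n-1}x_n},\qquad n\in\mathbb{N}_0,$$ with nonzero real initial values $x_{-2},x_{-1},x_0,y_{-2},y_{-1},y_0$. Let $(T_n)_{n\ge 0}$ be the Tetranacci sequence, defined by $T_0=T_1=0$, $T_2=T_3=1$ and $T_{n+4}=T_{n+3}+T_{n+2}+T_{n+1}+T_n$ for $n\in\mathbb{N}_0$. If $\{x_n,y_n\}_{n\ge -2}$ is a well defined solution of the system, then for every $n\in\mathbb{N}_0$ $$x_{2n+1}=\frac{T_{2n+2}+(T_{2n+2}+T_{2n+1})y_{-2}+(T_{2n+4}-T_{2n+3})x_{-1}y_{-2}+T_{2n+3}\,y_0x_{-1}y_{-2}}{T_{2n+1}+(T_{2n+1}+T_{2n})y_{-2}+(T_{2n+3}-T_{2n+2})x_{-1}y_{-2}+T_{2n+2}\,y_0x_{-1}y_{-2}},$$ $$x_{2n+2}=\frac{T_{2n+3}+(T_{2n+3}+T_{2n+2})x_{-2}+(T_{2n+5}-T_{2n+4})y_{-1}x_{-2}+T_{2n+4}\,x_0y_{-1}x_{-2}}{T_{2n+2}+(T_{2n+2}+T_{2n+1})x_{-2}+(T_{2n+4}-T_{2n+3})y_{-1}x_{-2}+T_{2n+3}\,x_0y_{-1}x_{-2}},$$ $$y_{2n+1}=\frac{T_{2n+2}+(T_{2n+2}+T_{2n+1})x_{-2}+(T_{2n+4}-T_{2n+3})y_{-1}x_{-2}+T_{2n+3}\,x_0y_{-1}x_{-2}}{T_{2n+1}+(T_{2n+1}+T_{2n})x_{-2}+(T_{2n+3}-T_{2n+2})y_{-1}x_{-2}+T_{2n+2}\,x_0y_{-1}x_{-2}},$$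 $$y_{2n+2}=\frac{T_{2n+3}+(T_{2n+3}+T_{2n+2})y_{-2}+(T_{2n+5}-T_{2n+4})x_{-1}y_{-2}+T_{2n+4}\,y_0x_{-1}y_{-2}}{T_{2n+2}+(T_{2n+2}+T_{2n+1})y_{-2}+(T_{2n+4}-T_{2n+3})x_{-1}y_{-2}+T_{2n+3}\,y_0x_{-1}y_{-2}}.$$
   Context: $\mathbb{N}_0=\{0,1,2,\dots\}$. A well defined solution of the system is a pair of real sequences $(x_n)_{n\ge -2}$, $(y_n)_{n\ge -2}$ satisfying both recurrences for all $n\in\mathbb{N}_0$ and such that $x_ny_n\neq 0$ for all $n\ge -2$. *)

theory Defs
  imports Complex_Main
begin

fun tetranacci :: "nat \<Rightarrow> int" where
  "tetranacci 0 = 0"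
| "tetranacci (Suc 0) = 0"
| "tetranacci (Suc (Suc 0)) = 1"
| "tetranacci (Suc (Suc (Suc 0))) = 1"
| "tetranacci (Suc (Suc (Suc (Suc n)))) =
     tetranacci (Suc (Suc (Suc n))) + tetranacci (Suc (Suc n)) + tetranacci (Suc n) + tetranacci n"

(* Sequences indexed by n \<ge> -2 are functions on int; values below -2 are never referred to. *)

definition solves_system :: "(int \<Rightarrow> real) \<Rightarrow> (int \<Rightarrow> real) \<Rightarrow> bool" where
  "solves_system x y \<longleftrightarrow>
     (\<forall>n\<ge>0.
        x (n + 1) = (y (n - 2) * x (n - 1) * y n + x (n - 1) * y (n - 2) + y (n - 2) + 1)
                      / (y (n - 2) * x (n - 1) * y n) \<and>
        y (n + 1) = (x (n - 2) * y (n - 1) * x n + y (n - 1) * x (n - 2) + x (n - 2) + 1)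
                      / (x (n - 2) * y (n - 1) * x n))"

(* Nonvanishing for all n \<ge> -2 covers the initial values and makes every denominator of
   the recurrences nonzero, so the convention a / 0 = 0 plays no role. *)

definition well_defined_solution :: "(int \<Rightarrow> real) \<Rightarrow> (int \<Rightarrow> real) \<Rightarrow> bool" where
  "well_defined_solution x y \<longleftrightarrow> solves_system x y \<and> (\<forall>n\<ge>-2. x n * y n \<noteq> 0)"

end

(* Interlacing the two sequences as y, x, y, x, ... (or x, y, x, y, ...) from index -2 decouples the
   system into one scalar recurrence solved twice. Clearing its denominators and multiplying by
   all earlier terms shows that the partial products of a scalar solution satisfy the linear
   Tetranacci recurrence; each term of the solution is the ratio of two consecutive products. *)
theory Submission
  imports Defs
begin

text \<open>Both sides satisfy the same linear recurrence of order four in \<open>n\<close>, so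
  agreement for \<open>n\<close> = 0, 1, 2, 3 suffices. The coefficient of \<open>u 2\<close> is
  T(n+1) + T(n) + T(n-1) in disguise; writing it as a difference avoids the index -1 at
  \<open>n = 0\<close>.\<close>

lemma linear_tetranacci_solution:
  fixes u :: "nat \<Rightarrow> 'a::comm_ring_1"
  assumes rec: "\<And>n. u (n + 4) = u (n + 3) + u (n + 2) + u (n + 1) + u n"
  shows "u (n + 3) = of_int (tetranacci (n + 1)) * u 0
           + of_int (tetranacci (n + 1) + tetranacci n) * u 1
           + of_int (tetranacci (n + 3) - tetranacci (n + 2)) * u 2
           + of_int (tetranacci (n + 2)) * u 3"
proof (induction n rule: less_induct)
  case (less n)
  consider "n = 0" | "n = 1" | "n = 2" | "n = 3" | m where "n = m + 4"
  proof (cases "n < 4")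
    case False
    then show ?thesis
      using that(5)[of "n - 4"] by simp
  qed (use that(1-4) in linarith)
  then show ?case
  proof cases
    case (5 m)
    \<comment> \<open>Here the left side is \<open>u (m + 7)\<close>, which \<open>rec\<close> at
      \<open>m + 3\<close> expresses by the four values covered by the induction hypotheses.\<close>
    show ?thesis
      using less[of m] less[of "m + 1"] less[of "m + 2"] less[of "m + 3"]
        rec[of "m + 3"]
      by (simp add: 5 numeral_eq_Suc algebra_simps)
  qed (use rec[of 0] rec[of 1] rec[of 2] in \<open>simp_all add: numeral_eq_Suc algebra_simps\<close>)
qed

text \<open>Numerator and denominator are the products of the first \<open>n + 4\<close> and
  \<open>n + 3\<close> terms of \<open>z\<close>. The denominator is therefore nonzero, and the
  quotient is a genuine one.\<close>

lemma scalar_solution: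
  fixes z :: "nat \<Rightarrow> 'a::field"
  assumes nz: "\<And>k. z k \<noteq> 0"
    and rec: "\<And>k. z (k + 3) = (z k * z (k + 1) * z (k + 2) + z (k + 1) * z k + z k + 1)
                        / (z k * z (k + 1) * z (k + 2))"
  shows "z (n + 3) =
      (of_int (tetranacci (n + 2)) + of_int (tetranacci (n + 2) + tetranacci (n + 1)) * z 0
         + of_int (tetranacci (n + 4) - tetranacci (n + 3)) * z 1 * z 0
         + of_int (tetranacci (n + 3)) * z 2 * z 1 * z 0)
      / (of_int (tetranacci (n + 1)) + of_int (tetranacci (n + 1) + tetranacci n) * z 0
         + of_int (tetranacci (n + 3) - tetranacci (n + 2)) * z 1 * z 0
         + of_int (tetranacci (n + 2)) * z 2 * z 1 * z 0)"
proof -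
  \<comment> \<open>The empty product \<open>p 0 = 1\<close> is what yields the terms free of
    \<open>z\<close> in the closed form.\<close>
  define p where "p m = (\<Prod>k<m. z k)" for m
  have p_Suc: "p (Suc m) = p m * z m" for m
    by (simp add: p_def)
  have p_init: "p 0 = 1" "p 1 = z 0" "p 2 = z 0 * z 1" "p 3 = z 0 * z 1 * z 2"
    by (simp_all add: p_def numeral_eq_Suc)
  have p_nz: "p m \<noteq> 0" for m
    by (simp add: p_def nz)
  have "p (m + 4) = p (m + 3) + p (m + 2) + p (m + 1) + p m" for m
  proof -
    \<comment> \<open>This is the recurrence with its denominator cleared. Each monomial is a
      product of consecutive terms starting at \<open>z m\<close>, so the factor \<open>p m\<close>
      completes it to a value of \<open>p\<close>.\<close>
    have "z m * z (m + 1) * z (m + 2) * z (m + 3)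
            = z m * z (m + 1) * z (m + 2) + z (m + 1) * z m + z m + 1"
      by (simp add: rec nz)
    then have "p m * (z m * z (m + 1) * z (m + 2) * z (m + 3))
            = p m * (z m * z (m + 1) * z (m + 2) + z (m + 1) * z m + z m + 1)"
      by simp
    then show ?thesis
      by (simp add: p_Suc numeral_eq_Suc algebra_simps)
  qed
  note p_closed = linear_tetranacci_solution[of p, OF this]
  have "z (n + 3) = p (n + 1 + 3) / p (n + 3)"
    using p_nz[of "n + 3"] by (simp add: p_Suc numeral_eq_Suc)
  also have "p (n + 3) = of_int (tetranacci (n + 1))
         + of_int (tetranacci (n + 1) + tetranacci n) * z 0
         + of_int (tetranacci (n + 3) - tetranacci (n + 2)) * z 1 * z 0
         + of_int (tetranacci (n + 2)) * z 2 * z 1 * z 0"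
    unfolding p_closed p_init by (simp add: mult_ac)
  also have "p (n + 1 + 3) = of_int (tetranacci (n + 2))
         + of_int (tetranacci (n + 2) + tetranacci (n + 1)) * z 0
         + of_int (tetranacci (n + 4) - tetranacci (n + 3)) * z 1 * z 0
         + of_int (tetranacci (n + 3)) * z 2 * z 1 * z 0"
    \<comment> \<open>The indices only have to be brought to a common successor form; the Tetranacci
      equation would unfold the values at those indices.\<close>
    unfolding p_closed p_init by (simp add: mult_ac numeral_eq_Suc del: tetranacci.simps)
  finally show ?thesis .
qed

text \<open>The shift by 2 moves the start to index 0. The system at \<open>n = k\<close> supplies
  the recurrence at \<open>k\<close>: its first equation for even \<open>k\<close>, its second for
  odd \<open>k\<close>.\<close>

lemma interlaced_solution:
  fixes x y :: "int \<Rightarrow> real"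
  assumes sol: "well_defined_solution x y"
    and z_def: "\<And>k. z k = (if even k then y else x) (int k - 2)"
  shows "z k \<noteq> 0"
    and "z (k + 3) = (z k * z (k + 1) * z (k + 2) + z (k + 1) * z k + z k + 1)
                        / (z k * z (k + 1) * z (k + 2))"
proof -
  show "z k \<noteq> 0"
    using sol by (auto simp: z_def well_defined_solution_def)
  have "x (int k + 1) = (y (int k - 2) * x (int k - 1) * y (int k)
            + x (int k - 1) * y (int k - 2) + y (int k - 2) + 1)
          / (y (int k - 2) * x (int k - 1) * y (int k))"
    and "y (int k + 1) = (x (int k - 2) * y (int k - 1) * x (int k)
            + y (int k - 1) * x (int k - 2) + x (int k - 2) + 1)
          / (x (int k - 2) * y (int k - 1) * x (int k))"
    using sol by (auto simp: well_defined_solution_def solves_system_def)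
  then show "z (k + 3) = (z k * z (k + 1) * z (k + 2) + z (k + 1) * z k + z k + 1)
                        / (z k * z (k + 1) * z (k + 2))"
    by (simp add: z_def add.commute[of 1])
qed

lemma well_defined_solution_swap:
  "well_defined_solution x y \<Longrightarrow> well_defined_solution y x"
  by (auto simp: well_defined_solution_def solves_system_def)

text \<open>These two formulas belong together because \<open>x\<close> at odd and \<open>y\<close>
  at even indices lie on the one interlaced sequence starting at \<open>y (-2)\<close>.\<close>

lemma solution_closed_form:
  fixes x y :: "int \<Rightarrow> real" and n :: nat
  assumes "well_defined_solution x y"
  shows "x (2 * int n + 1) =
        (tetranacci (2 * n + 2) + (tetranacci (2 * n + 2) + tetranacci (2 * n + 1)) * y (-2)
         + (tetranacci (2 * n + 4) - tetranacci (2 * n + 3)) * x (-1) * y (-2)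
         + tetranacci (2 * n + 3) * y 0 * x (-1) * y (-2))
      / (tetranacci (2 * n + 1) + (tetranacci (2 * n + 1) + tetranacci (2 * n)) * y (-2)
         + (tetranacci (2 * n + 3) - tetranacci (2 * n + 2)) * x (-1) * y (-2)
         + tetranacci (2 * n + 2) * y 0 * x (-1) * y (-2))" (is ?odd)
    and "y (2 * int n + 2) =
        (tetranacci (2 * n + 3) + (tetranacci (2 * n + 3) + tetranacci (2 * n + 2)) * y (-2)
         + (tetranacci (2 * n + 5) - tetranacci (2 * n + 4)) * x (-1) * y (-2)
         + tetranacci (2 * n + 4) * y 0 * x (-1) * y (-2))
      / (tetranacci (2 * n + 2) + (tetranacci (2 * n + 2) + tetranacci (2 * n + 1)) * y (-2)
         + (tetranacci (2 * n + 4) - tetranacci (2 * n + 3)) * x (-1) * y (-2)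
         + tetranacci (2 * n + 3) * y 0 * x (-1) * y (-2))" (is ?even)
proof -
  define z where "z k = (if even k then y else x) (int k - 2)" for k
  note closed = scalar_solution[of z, OF interlaced_solution[OF assms z_def]]
  have init: "z 0 = y (-2)" "z 1 = x (-1)" "z 2 = y 0"
    by (simp_all add: z_def)
  have "x (2 * int n + 1) = z (2 * n + 3)" "y (2 * int n + 2) = z (2 * n + 1 + 3)"
    by (simp_all add: z_def algebra_simps)
  then show ?odd ?even
    using closed[of "2 * n"] closed[of "2 * n + 1"]
    unfolding init by (simp_all only: add.assoc one_plus_numeral semiring_norm one_add_one)
qed

theorem corollary2:
  fixes x y :: "int \<Rightarrow> real" and n :: nat
  assumes "well_defined_solution x y"
  shows "
    x (2 * int n + 1) =
        (tetranacci (2 * n + 2) + (tetranacci (2 * n + 2) + tetranacci (2 * n + 1)) * y (-2)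
         + (tetranacci (2 * n + 4) - tetranacci (2 * n + 3)) * x (-1) * y (-2)
         + tetranacci (2 * n + 3) * y 0 * x (-1) * y (-2))
      / (tetranacci (2 * n + 1) + (tetranacci (2 * n + 1) + tetranacci (2 * n)) * y (-2)
         + (tetranacci (2 * n + 3) - tetranacci (2 * n + 2)) * x (-1) * y (-2)
         + tetranacci (2 * n + 2) * y 0 * x (-1) * y (-2)) \<and>
    x (2 * int n + 2) =
        (tetranacci (2 * n + 3) + (tetranacci (2 * n + 3) + tetranacci (2 * n + 2)) * x (-2)
         + (tetranacci (2 * n + 5) - tetranacci (2 * n + 4)) * y (-1) * x (-2)
         + tetranacci (2 * n + 4) * x 0 * y (-1) * x (-2))
      / (tetranacci (2 * n + 2) + (tetranacci (2 * n + 2) + tetranacci (2 * n + 1)) * x (-2)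
         + (tetranacci (2 * n + 4) - tetranacci (2 * n + 3)) * y (-1) * x (-2)
         + tetranacci (2 * n + 3) * x 0 * y (-1) * x (-2)) \<and>
    y (2 * int n + 1) =
        (tetranacci (2 * n + 2) + (tetranacci (2 * n + 2) + tetranacci (2 * n + 1)) * x (-2)
         + (tetranacci (2 * n + 4) - tetranacci (2 * n + 3)) * y (-1) * x (-2)
         + tetranacci (2 * n + 3) * x 0 * y (-1) * x (-2))
      / (tetranacci (2 * n + 1) + (tetranacci (2 * n + 1) + tetranacci (2 * n)) * x (-2)
         + (tetranacci (2 * n + 3) - tetranacci (2 * n + 2)) * y (-1) * x (-2)
         + tetranacci (2 * n + 2) * x 0 * y (-1) * x (-2)) \<and>
    y (2 * int n + 2) =
        (tetranacci (2 * n + 3) + (tetranacci (2 * n + 3) + tetranacci (2 * n + 2)) * y (-2)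
         + (tetranacci (2 * n + 5) - tetranacci (2 * n + 4)) * x (-1) * y (-2)
         + tetranacci (2 * n + 4) * y 0 * x (-1) * y (-2))
      / (tetranacci (2 * n + 2) + (tetranacci (2 * n + 2) + tetranacci (2 * n + 1)) * y (-2)
         + (tetranacci (2 * n + 4) - tetranacci (2 * n + 3)) * x (-1) * y (-2)
         + tetranacci (2 * n + 3) * y 0 * x (-1) * y (-2))"
  \<comment> \<open>The pair as given yields the first and fourth formulas. The system is symmetric
    in \<open>x\<close> and \<open>y\<close>, and the swapped pair yields the third and
    second.\<close>
  using solution_closed_form[OF assms, of n]
    solution_closed_form[OF well_defined_solution_swap[OF assms], of n]
  by blast

end
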